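(* Let $A\in\mathbb{R}^{n\times n}$, $n=2\ell$, be nonsingular and skew-symmetric with simple eigenvalues, let $m<\ell$, and let $P_m=[p_1,\dots,p_m]$ and $Q_{m+1}=[q_1,\dots,q_{m+1}]$ be generated by the $m$-step SSLBD process applied to $A$ with a unit-length starting vector $q_1\in\mathbb{R}^n$, without breakdown. Then $P_m$ and $Q_{m+1}$ are biorthogonal: $$Q_{m+1}^TP_m=\mathbf{0}.$$
   Context: The $m$-step SSLBD (skew-symmetric Lanczos bidiagonalization) process, in exact arithmetic: set $\gamma_0=0$, $p_0=\mathbf{0}$ and choose $q_1\in\mathbb{R}^n$ with $\|q_1\|=1$. For $j=1,\dots,m$: compute $s_j=Aq_j-\gamma_{j-1}p_{j-1}$ and $\beta_j=\|s_j\|$; if $\beta_j=0$ then break (breakdown), otherwise set $p_j=s_j/\beta_j$; compute $t_j=-Ap_j-\beta_jq_j$ and $\gamma_j=\|t_j\|$; if $\gamma_j=0$ then break (breakdown), otherwise set $q_{j+1}=t_j/\gamma_j$. Here $\|\cdot\|$ is the 2-norm. "Without breakdown" means $\beta_j>0$ and $\gamma_j>0$ for $j=1,\dots,m$. *)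

theory Defs
  imports "Jordan_Normal_Form.Char_Poly"
begin

definition skew_symmetric_mat :: "real mat \<Rightarrow> bool" where
  "skew_symmetric_mat A \<longleftrightarrow> square_mat A \<and> A\<^sup>T = - A"

text \<open>The eigenvalues of a real matrix are its complex eigenvalues (those of a skew-symmetric
  matrix are purely imaginary); simplicity refers to the algebraic multiplicity.\<close>

definition simple_eigenvalues :: "real mat \<Rightarrow> bool" where
  "simple_eigenvalues A \<longleftrightarrow>
     (let B = map_mat complex_of_real A
      in \<forall>z. eigenvalue B z \<longrightarrow> order z (char_poly B) = 1)"

definition norm2 :: "real vec \<Rightarrow> real" where
  "norm2 v = sqrt (v \<bullet> v)"

text \<open>The state after step \<open>j\<close> is the tuple \<open>(\<beta>\<^sub>j, \<gamma>\<^sub>j, p\<^sub>j, q\<^sub>j\<^sub>+\<^sub>1)\<close>; the \<open>\<beta>\<close>-component of the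
  initial state is a dummy.  The recursion is total because \<open>1 / 0 = 0\<close>, so nothing is meaningful
  from a breakdown onwards; the breakdown test is the predicate \<open>sslbd_no_breakdown\<close>.\<close>

primrec sslbd :: "real mat \<Rightarrow> real vec \<Rightarrow> nat \<Rightarrow> real \<times> real \<times> real vec \<times> real vec" where
  "sslbd A q1 0 = (0, 0, 0\<^sub>v (dim_row A), q1)"
| "sslbd A q1 (Suc j) =
     (case sslbd A q1 j of (_, \<gamma>, p, q) \<Rightarrow>
        let s = A *\<^sub>v q - \<gamma> \<cdot>\<^sub>v p;
            \<beta> = norm2 s;
            p' = (1 / \<beta>) \<cdot>\<^sub>v s;
            t = - (A *\<^sub>v p') - \<beta> \<cdot>\<^sub>v q;
            \<gamma>' = norm2 t;
            q' = (1 / \<gamma>') \<cdot>\<^sub>v t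
        in (\<beta>, \<gamma>', p', q'))"

definition sslbd_beta :: "real mat \<Rightarrow> real vec \<Rightarrow> nat \<Rightarrow> real" where
  "sslbd_beta A q1 j = fst (sslbd A q1 j)"

definition sslbd_gamma :: "real mat \<Rightarrow> real vec \<Rightarrow> nat \<Rightarrow> real" where
  "sslbd_gamma A q1 j = fst (snd (sslbd A q1 j))"

definition sslbd_p :: "real mat \<Rightarrow> real vec \<Rightarrow> nat \<Rightarrow> real vec" where
  "sslbd_p A q1 j = fst (snd (snd (sslbd A q1 j)))"

text \<open>Only used for \<open>j \<ge> 1\<close>, since \<open>q\<^sub>j\<close> is stored in state \<open>j - 1\<close>.\<close>

definition sslbd_q :: "real mat \<Rightarrow> real vec \<Rightarrow> nat \<Rightarrow> real vec" where
  "sslbd_q A q1 j = snd (snd (snd (sslbd A q1 (j - 1))))"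

definition sslbd_no_breakdown :: "real mat \<Rightarrow> real vec \<Rightarrow> nat \<Rightarrow> bool" where
  "sslbd_no_breakdown A q1 m \<longleftrightarrow>
     (\<forall>j\<in>{1..m}. sslbd_beta A q1 j > 0 \<and> sslbd_gamma A q1 j > 0)"

definition sslbd_P :: "real mat \<Rightarrow> real vec \<Rightarrow> nat \<Rightarrow> real mat" where
  "sslbd_P A q1 k = mat_of_cols (dim_row A) (map (sslbd_p A q1) [1..<Suc k])"

definition sslbd_Q :: "real mat \<Rightarrow> real vec \<Rightarrow> nat \<Rightarrow> real mat" where
  "sslbd_Q A q1 k = mat_of_cols (dim_row A) (map (sslbd_q A q1) [1..<Suc k])"

lemma sslbd_init:
  "sslbd_gamma A q1 0 = 0" "sslbd_p A q1 0 = 0\<^sub>v (dim_row A)" "sslbd_q A q1 1 = q1"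
  by (simp_all add: sslbd_gamma_def sslbd_p_def sslbd_q_def)

lemma sslbd_step:
  fixes A :: "real mat" and q1 :: "real vec" and j :: nat
  assumes "j \<ge> 1"
  defines "s \<equiv> A *\<^sub>v sslbd_q A q1 j - sslbd_gamma A q1 (j - 1) \<cdot>\<^sub>v sslbd_p A q1 (j - 1)"
  defines "t \<equiv> - (A *\<^sub>v sslbd_p A q1 j) - sslbd_beta A q1 j \<cdot>\<^sub>v sslbd_q A q1 j"
  shows "sslbd_beta A q1 j = norm2 s"
    and "sslbd_p A q1 j = (1 / sslbd_beta A q1 j) \<cdot>\<^sub>v s"
    and "sslbd_gamma A q1 j = norm2 t"
    and "sslbd_q A q1 (j + 1) = (1 / sslbd_gamma A q1 j) \<cdot>\<^sub>v t"
proof -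
  obtain i where "j = Suc i"
    using assms(1) by (cases j) auto
  then show "sslbd_beta A q1 j = norm2 s"
    and "sslbd_p A q1 j = (1 / sslbd_beta A q1 j) \<cdot>\<^sub>v s"
    and "sslbd_gamma A q1 j = norm2 t"
    and "sslbd_q A q1 (j + 1) = (1 / sslbd_gamma A q1 j) \<cdot>\<^sub>v t"
    unfolding s_def t_def
    by (simp_all add: sslbd_beta_def sslbd_gamma_def sslbd_p_def sslbd_q_def Let_def
        split: prod.splits)
qed

end

theory Submission
  imports Defs
begin

text \<open>Each \<open>p\<^sub>j\<close> is an odd polynomial in \<open>A\<close> applied to \<open>q\<^sub>1\<close>, hence \<open>p\<^sub>j = X q\<^sub>1\<close> with \<open>X\<close>
  skew-symmetric, and each \<open>q\<^sub>i\<close> is an even polynomial in \<open>A\<close> applied to \<open>q\<^sub>1\<close>, hence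
  \<open>q\<^sub>i = Y q\<^sub>1\<close> with \<open>Y\<close> symmetric. Since \<open>X\<close> and \<open>Y\<close> commute, \<open>Y X\<close> is skew-symmetric, and so
  \<open>q\<^sub>i \<bullet> p\<^sub>j = q\<^sub>1 \<bullet> Y X q\<^sub>1 = 0\<close>.\<close>

text \<open>Membership in the double commutant replaces being a polynomial in \<open>A\<close>; the sign \<open>e\<close>
  is the parity of that polynomial when \<open>A\<close> is skew-symmetric.\<close>

definition bicommutant_sign :: "nat \<Rightarrow> real mat \<Rightarrow> real \<Rightarrow> real mat \<Rightarrow> bool" where
  "bicommutant_sign n A e X \<longleftrightarrow> X \<in> carrier_mat n n \<and> X\<^sup>T = e \<cdot>\<^sub>m X \<and>
     (\<forall>Z \<in> carrier_mat n n. Z * A = A * Z \<longrightarrow> Z * X = X * Z)"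

lemma smult_mat_mult_vec:
  fixes X :: "real mat"
  assumes "X \<in> carrier_mat nr nc" "v \<in> carrier_vec nc"
  shows "(c \<cdot>\<^sub>m X) *\<^sub>v v = c \<cdot>\<^sub>v (X *\<^sub>v v)"
  using assms by (intro eq_vecI) auto

lemma bicommutant_sign_one: "bicommutant_sign n A 1 (1\<^sub>m n)"
  by (auto simp: bicommutant_sign_def)

text \<open>Zero is both symmetric and skew-symmetric, so \<open>e\<close> stays free; the vector
  p_0 = 0 uses it with sign -1.\<close>

lemma bicommutant_sign_zero: "bicommutant_sign n A e (0\<^sub>m n n)"
  by (auto simp: bicommutant_sign_def)

lemma bicommutant_sign_smult:
  assumes "bicommutant_sign n A e X"
  shows "bicommutant_sign n A e (c \<cdot>\<^sub>m X)"
proof -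
  have X: "X \<in> carrier_mat n n" and T: "X\<^sup>T = e \<cdot>\<^sub>m X"
    using assms by (auto simp: bicommutant_sign_def)
  have "(c \<cdot>\<^sub>m X)\<^sup>T = c \<cdot>\<^sub>m X\<^sup>T"
    by (rule eq_matI) auto
  also have "\<dots> = e \<cdot>\<^sub>m (c \<cdot>\<^sub>m X)"
    unfolding T by (rule eq_matI) auto
  finally have "(c \<cdot>\<^sub>m X)\<^sup>T = e \<cdot>\<^sub>m (c \<cdot>\<^sub>m X)" .
  moreover have "Z * (c \<cdot>\<^sub>m X) = c \<cdot>\<^sub>m X * Z"
    if "Z \<in> carrier_mat n n" "Z * A = A * Z" for Z
    using that assms X
    by (simp add: bicommutant_sign_def mult_smult_distrib[OF that(1) X]
        mult_smult_assoc_mat[OF X that(1)])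
  ultimately show ?thesis
    using X by (auto simp: bicommutant_sign_def)
qed

lemma bicommutant_sign_minus:
  assumes "bicommutant_sign n A e X" "bicommutant_sign n A e Y"
  shows "bicommutant_sign n A e (X - Y)"
proof -
  have X: "X \<in> carrier_mat n n" and TX: "X\<^sup>T = e \<cdot>\<^sub>m X"
    and Y: "Y \<in> carrier_mat n n" and TY: "Y\<^sup>T = e \<cdot>\<^sub>m Y"
    using assms by (auto simp: bicommutant_sign_def)
  have "(X - Y)\<^sup>T = X\<^sup>T - Y\<^sup>T"
    using X Y by (intro eq_matI) auto
  also have "\<dots> = e \<cdot>\<^sub>m (X - Y)"
    unfolding TX TY using X Y by (intro eq_matI) (auto simp: algebra_simps)
  finally have "(X - Y)\<^sup>T = e \<cdot>\<^sub>m (X - Y)" .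
  moreover have "Z * (X - Y) = (X - Y) * Z"
    if "Z \<in> carrier_mat n n" "Z * A = A * Z" for Z
    using that assms X Y
    by (simp add: bicommutant_sign_def mult_minus_distrib_mat[OF that(1) X Y]
        minus_mult_distrib_mat[OF X Y that(1)])
  ultimately show ?thesis
    using X Y by (auto simp: bicommutant_sign_def)
qed

text \<open>Transposition gives \<open>X\<^sup>T * A\<^sup>T\<close>, which is -e times X A, and X
  commutes with A because \<open>Z = A\<close> is admissible in the commutation condition. This
  parity flip is what separates the p's from the q's.\<close>

lemma bicommutant_sign_mult:
  assumes A: "A \<in> carrier_mat n n" and skew: "A\<^sup>T = - A"
    and "bicommutant_sign n A e X"
  shows "bicommutant_sign n A (- e) (A * X)"
proof -
  have X: "X \<in> carrier_mat n n" and T: "X\<^sup>T = e \<cdot>\<^sub>m X"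
    and comm: "\<And>Z. Z \<in> carrier_mat n n \<Longrightarrow> Z * A = A * Z \<Longrightarrow> Z * X = X * Z"
    using assms by (auto simp: bicommutant_sign_def)
  have "(A * X)\<^sup>T = (e \<cdot>\<^sub>m X) * (- A)"
    using transpose_mult[OF A X] T skew by simp
  \<comment> \<open>Once the minus sign is a scalar factor, both scalars can be pulled out of the
    product.\<close>
  also have "\<dots> = (e \<cdot>\<^sub>m X) * ((-1) \<cdot>\<^sub>m A)"
    by (rule arg_cong[where f = "(*) (e \<cdot>\<^sub>m X)"]) (rule eq_matI, auto)
  also have "\<dots> = (- e) \<cdot>\<^sub>m (X * A)"
    using X A by (intro eq_matI) auto
  finally have "(A * X)\<^sup>T = (- e) \<cdot>\<^sub>m (A * X)"
    using comm[OF A] by simp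
  moreover have "Z * (A * X) = A * X * Z"
    if Z: "Z \<in> carrier_mat n n" and ZA: "Z * A = A * Z" for Z
    using assoc_mult_mat[OF Z A X] assoc_mult_mat[OF A Z X] assoc_mult_mat[OF A X Z]
      comm[OF Z ZA] ZA by simp
  ultimately show ?thesis
    using X A by (auto simp: bicommutant_sign_def)
qed

lemma bicommutant_sign_orthogonal:
  assumes A: "A \<in> carrier_mat n n" and v: "v \<in> carrier_vec n"
    and symY: "bicommutant_sign n A 1 Y" and skewX: "bicommutant_sign n A (- 1) X"
  shows "(Y *\<^sub>v v) \<bullet> (X *\<^sub>v v) = 0"
proof -
  have X: "X \<in> carrier_mat n n" and TX: "X\<^sup>T = (- 1) \<cdot>\<^sub>m X"
    and Y: "Y \<in> carrier_mat n n" and TY: "Y\<^sup>T = Y"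
    using assms by (auto simp: bicommutant_sign_def)
  \<comment> \<open>The double commutant is used twice: \<open>Z = A\<close> shows that Y commutes
    with A, and then \<open>Z = Y\<close> is admissible in the condition on X.\<close>
  have "Y * A = A * Y"
    using symY A by (auto simp: bicommutant_sign_def)
  then have comm: "Y * X = X * Y"
    using skewX Y by (auto simp: bicommutant_sign_def)
  have "(Y *\<^sub>v v) \<bullet> (X *\<^sub>v v) = v \<bullet> (Y *\<^sub>v (X *\<^sub>v v))"
    using transpose_vec_mult_scalar[of Y n n "X *\<^sub>v v" v] X Y TY v
    by (simp add: comm_scalar_prod[of _ n])
  also have "\<dots> = v \<bullet> (X *\<^sub>v (Y *\<^sub>v v))"
    using X Y v comm by (metis assoc_mult_mat_vec)
  also have "\<dots> = (X\<^sup>T *\<^sub>v v) \<bullet> (Y *\<^sub>v v)"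
    using transpose_vec_mult_scalar[of X n n "Y *\<^sub>v v" v] X Y v by simp
  \<comment> \<open>Moving X across produced the only sign change, so the scalar product equals its
    own negative.\<close>
  also have "\<dots> = - ((Y *\<^sub>v v) \<bullet> (X *\<^sub>v v))"
    unfolding TX using X Y v
    by (simp add: smult_mat_mult_vec[of _ n n] comm_scalar_prod[of _ n])
  finally show ?thesis by simp
qed

text \<open>The two claims need a joint induction, since each recurrence feeds on the other
  sequence. In each one A acts on the vector of opposite parity, so both terms of the difference
  have the same sign. The pairing of p_j with q_(j+1) is that of the state after step j.\<close>

lemma sslbd_representation:
  assumes A: "A \<in> carrier_mat n n" and skew: "A\<^sup>T = - A" and q1: "q1 \<in> carrier_vec n"
  shows "(\<exists>X. bicommutant_sign n A (- 1) X \<and> sslbd_p A q1 j = X *\<^sub>v q1) \<and>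
    (\<exists>Y. bicommutant_sign n A 1 Y \<and> sslbd_q A q1 (j + 1) = Y *\<^sub>v q1)"
proof (induction j)
  case 0
  have "sslbd_p A q1 0 = 0\<^sub>m n n *\<^sub>v q1"
    using A q1 by (auto simp: sslbd_init)
  moreover have "sslbd_q A q1 (0 + 1) = 1\<^sub>m n *\<^sub>v q1"
    using q1 sslbd_init(3) by simp
  ultimately show ?case
    using bicommutant_sign_zero bicommutant_sign_one by blast
next
  case (Suc j)
  obtain X Y where X: "bicommutant_sign n A (- 1) X" "sslbd_p A q1 j = X *\<^sub>v q1"
    and Y: "bicommutant_sign n A 1 Y" "sslbd_q A q1 (j + 1) = Y *\<^sub>v q1"
    using Suc.IH by blast
  define \<beta> \<gamma> \<gamma>' where "\<beta> = sslbd_beta A q1 (Suc j)" and "\<gamma> = sslbd_gamma A q1 j"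
    and "\<gamma>' = sslbd_gamma A q1 (Suc j)"
  \<comment> \<open>The witnesses are the recurrences for p and q with the common factor
    \<open>q1\<close> stripped off. The factor -1 in \<open>Y'\<close> is a scaling, so that closure
    under scalar multiples covers it.\<close>
  define X' where "X' = (1 / \<beta>) \<cdot>\<^sub>m (A * Y - \<gamma> \<cdot>\<^sub>m X)"
  define Y' where "Y' = (1 / \<gamma>') \<cdot>\<^sub>m ((- 1) \<cdot>\<^sub>m (A * X') - \<beta> \<cdot>\<^sub>m Y)"
  have X': "bicommutant_sign n A (- 1) X'"
    unfolding X'_def using X(1) bicommutant_sign_mult[OF A skew Y(1)]
    by (intro bicommutant_sign_smult bicommutant_sign_minus)
  have Y': "bicommutant_sign n A 1 Y'"
    unfolding Y'_def using Y(1) bicommutant_sign_mult[OF A skew X']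
    by (intro bicommutant_sign_smult bicommutant_sign_minus) simp_all
  have carr: "X \<in> carrier_mat n n" "Y \<in> carrier_mat n n" "X' \<in> carrier_mat n n"
    using X(1) Y(1) X' by (auto simp: bicommutant_sign_def)
  have "sslbd_p A q1 (Suc j) = (1 / \<beta>) \<cdot>\<^sub>v (A *\<^sub>v (Y *\<^sub>v q1) - \<gamma> \<cdot>\<^sub>v (X *\<^sub>v q1))"
    using sslbd_step(2)[of "Suc j" A q1] X(2) Y(2) by (simp add: \<beta>_def \<gamma>_def)
  also have "\<dots> = (1 / \<beta>) \<cdot>\<^sub>v ((A * Y - \<gamma> \<cdot>\<^sub>m X) *\<^sub>v q1)"
    using A carr q1 by (subst minus_mult_distrib_mat_vec[of _ n n])
      (simp_all add: smult_mat_mult_vec[of _ n n] assoc_mult_mat_vec[of _ n n _ n])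
  also have "\<dots> = X' *\<^sub>v q1"
    unfolding X'_def using A carr q1
    by (intro smult_mat_mult_vec[symmetric, of _ n n] minus_carrier_mat smult_carrier_mat)
  finally have p: "sslbd_p A q1 (Suc j) = X' *\<^sub>v q1" .
  have "sslbd_q A q1 (Suc j + 1) =
      (1 / \<gamma>') \<cdot>\<^sub>v (- (A *\<^sub>v (X' *\<^sub>v q1)) - \<beta> \<cdot>\<^sub>v (Y *\<^sub>v q1))"
    using sslbd_step(4)[of "Suc j" A q1] Y(2) p by (simp add: \<beta>_def \<gamma>'_def)
  also have "- (A *\<^sub>v (X' *\<^sub>v q1)) = (- 1) \<cdot>\<^sub>v (A *\<^sub>v (X' *\<^sub>v q1))"
    by (rule eq_vecI) auto
  also have "(1 / \<gamma>') \<cdot>\<^sub>v (\<dots> - \<beta> \<cdot>\<^sub>v (Y *\<^sub>v q1)) =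
      (1 / \<gamma>') \<cdot>\<^sub>v (((- 1) \<cdot>\<^sub>m (A * X') - \<beta> \<cdot>\<^sub>m Y) *\<^sub>v q1)"
    using A carr q1 by (subst minus_mult_distrib_mat_vec[of _ n n])
      (simp_all add: smult_mat_mult_vec[of _ n n] assoc_mult_mat_vec[of _ n n _ n])
  also have "\<dots> = Y' *\<^sub>v q1"
    unfolding Y'_def using A carr q1
    by (intro smult_mat_mult_vec[symmetric, of _ n n] minus_carrier_mat smult_carrier_mat)
  finally show ?case
    using p X' Y' by blast
qed

theorem theorem3p1:
  fixes A :: "real mat" and q1 :: "real vec" and n l m :: nat
  assumes "A \<in> carrier_mat n n" and "n = 2 * l"
    and "invertible_mat A"
    and "skew_symmetric_mat A"
    and "simple_eigenvalues A"
    and "m < l"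
    and "q1 \<in> carrier_vec n" and "norm2 q1 = 1"
    and "sslbd_no_breakdown A q1 m"
  shows "(sslbd_Q A q1 (m + 1))\<^sup>T * sslbd_P A q1 m = 0\<^sub>m (m + 1) m"
proof -
  have skew: "A\<^sup>T = - A"
    using assms(4) by (simp add: skew_symmetric_mat_def)
  note rep = sslbd_representation[OF assms(1) skew assms(7)]
  \<comment> \<open>The dimensions of the iterates are read off from their form: an n by n matrix
    applied to \<open>q1\<close>.\<close>
  have p_carr: "sslbd_p A q1 j \<in> carrier_vec n" for j
    using rep[of j] assms(7) by (auto simp: bicommutant_sign_def)
  have q_carr: "sslbd_q A q1 (Suc i) \<in> carrier_vec n" for i
    using rep[of i] assms(7) by (auto simp: bicommutant_sign_def)
  \<comment> \<open>State i supplies q_(i+1) but p_i, hence the different instances \<open>i\<close>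
    and \<open>Suc j\<close>.\<close>
  have orth: "sslbd_q A q1 (Suc i) \<bullet> sslbd_p A q1 (Suc j) = 0" for i j
    using rep[of i] rep[of "Suc j"] bicommutant_sign_orthogonal[OF assms(1,7)] by auto
  show ?thesis
  proof (rule eq_matI)
    fix i j assume "i < dim_row (0\<^sub>m (m + 1) m)" "j < dim_col (0\<^sub>m (m + 1) m)"
    then have ij: "i < Suc m" "j < m" by auto
    \<comment> \<open>Columns count from 0 and the iterates from 1. Without \<open>upt_Suc\<close>
      the index list stays whole and its entries can be looked up by position.\<close>
    have "col (sslbd_Q A q1 (m + 1)) i = sslbd_q A q1 (Suc i)"
      unfolding sslbd_Q_def using ij q_carr[of i] assms(1)
      by (subst col_mat_of_cols) (auto simp del: upt_Suc)
    moreover have "col (sslbd_P A q1 m) j = sslbd_p A q1 (Suc j)"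
      unfolding sslbd_P_def using ij p_carr[of "Suc j"] assms(1)
      by (subst col_mat_of_cols) (auto simp del: upt_Suc)
    moreover have "i < dim_col (sslbd_Q A q1 (m + 1))" "j < dim_col (sslbd_P A q1 m)"
      using ij by (auto simp: sslbd_Q_def sslbd_P_def simp del: upt_Suc)
    ultimately show "((sslbd_Q A q1 (m + 1))\<^sup>T * sslbd_P A q1 m) $$ (i, j)
        = 0\<^sub>m (m + 1) m $$ (i, j)"
      using orth ij by simp
  qed (auto simp: sslbd_Q_def sslbd_P_def simp del: upt_Suc)
qed

end
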